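(* Let $b$ be a connected graph over $X$, let $q:X\to\mathbb{R}$ be a given potential, and let $H=L+q$ be the associated formal Schrödinger operator with form $h$. Let $u$ and $v$ be positive $H$-superharmonic functions on $X$ that are $H$-harmonic outside of a finite set. Let $u_0:=u/v$, and assume that (a) $u_0:X\to(0,\infty)$ is proper, i.e. $u_0^{-1}(I)$ is finite for every compact $I\subseteq(0,\infty)$; (b) $\displaystyle\sup_{x,y\in X,\ x\sim y}\frac{u_0(x)}{u_0(y)}<\infty$. Then the function $$w:=\frac{H\left[(uv)^{1/2}\right]}{(uv)^{1/2}}$$ is an optimal Hardy-weight for $h$ in $X$, and $$w(x)=\frac12\sum_{y\in X}b(x,y)\left[\left(\frac{u(y)}{u(x)}\right)^{1/2}-\left(\frac{v(y)}{v(x)}\right)^{1/2}\right]^2$$ for all $x\in X$ satisfying $Hu(x)=Hv(x)=0$.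
   Context: $X$ is a countably infinite discrete set. A graph over $X$ is a symmetric function $b:X\times X\to[0,\infty)$ with zero diagonal and $\sum_{y}b(x,y)<\infty$ for all $x$ (not necessarily locally finite). Write $x\sim y$ if $b(x,y)>0$; $b$ is connected if any two vertices are joined by a finite path $x_0\sim x_1\sim\dots\sim x_n$. $C(W)$ is the space of real functions on $W\subseteq X$ and $C_c(W)$ the subspace of finitely supported ones, both viewed in $C(X)$ by extension by zero. A function $f$ is positive if $f\ge0$ and $f\ne0$. $F(X):=\{f\in C(X):\sum_y b(x,y)|f(y)|<\infty\ \forall x\}$; for $f\in F(X)$, $Lf(x):=\sum_{y}b(x,y)(f(x)-f(y))$ and $H:=L+q$. The form of $H$ is $$h(\varphi):=\tfrac12\sum_{x,y\in X}b(x,y)(\varphi(x)-\varphi(y))^2+\sum_{x\in X}q(x)\varphi(x)^2,\quad \varphi\in C_c(X).$$ $u$ is $H$-superharmonic ($H$-harmonic) on $W\subseteq X$ if $u\in F(X)$ and $Hu\ge0$ ($Hu=0$) on $W$. (Positive $H$-superharmonic functions on $X$ are strictly positive, by connectedness.) A function $w:X\to\mathbb{R}$ also denotes the quadratic form $w(\varphi):=\sum_x w(x)\varphi(x)^2$ on $C_c(X)$. Optimal Hardy-weight. Let $w:X\to[0,\infty)$ be positive with $h-w\ge0$ on $C_c(X)$. * $h-w$ is critical in $X$ if there is no positive $\tilde w\in C(X)$ with $h-w-\tilde w\ge0$ on $C_c(X)$. In this case there is a unique (up to constant multiples) positive $(H-w)$-superharmonic function $\psi$ on $X$; it is $(H-w)$-harmonic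 and is called the ground state of $h-w$. * $h-w$ is null-critical in $X$ with respect to $w$ if it is critical in $X$ and $\sum_X\psi^2w=\infty$, where $\psi$ is the ground state of $h-w$. * $w$ is optimal near infinity for $h$ if for every $\lambda>0$ and every finite $W\subseteq X$ the inequality $h-w\ge\lambda w$ fails to hold on $C_c(X\setminus W)$. $w$ is an optimal Hardy-weight for $h$ in $X$ if $h-w$ is critical in $X$, null-critical in $X$ with respect to $w$, and $w$ is optimal near infinity for $h$. *)

theory Defs
  imports "HOL-Analysis.Analysis"
begin

text \<open>
  The vertex set \<open>X\<close> is the whole type \<open>'a\<close>. Convergence of sums of nonnegative terms is
  expressed by \<open>summable_on\<close>.
\<close>

definition is_graph :: "('a \<Rightarrow> 'a \<Rightarrow> real) \<Rightarrow> bool" where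
  "is_graph b \<longleftrightarrow>
     (\<forall>x y. 0 \<le> b x y) \<and> (\<forall>x y. b x y = b y x) \<and> (\<forall>x. b x x = 0) \<and>
     (\<forall>x. (\<lambda>y. b x y) summable_on UNIV)"

definition adj :: "('a \<Rightarrow> 'a \<Rightarrow> real) \<Rightarrow> 'a \<Rightarrow> 'a \<Rightarrow> bool" where
  "adj b x y \<longleftrightarrow> b x y > 0"

definition connected_graph :: "('a \<Rightarrow> 'a \<Rightarrow> real) \<Rightarrow> bool" where
  "connected_graph b \<longleftrightarrow> (\<forall>x y. (adj b)\<^sup>*\<^sup>* x y)"

definition Cc :: "'a set \<Rightarrow> ('a \<Rightarrow> real) set" where
  "Cc W = {\<phi>. finite {x. \<phi> x \<noteq> 0} \<and> (\<forall>x. x \<notin> W \<longrightarrow> \<phi> x = 0)}"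

definition positive_fun :: "('a \<Rightarrow> real) \<Rightarrow> bool" where
  "positive_fun f \<longleftrightarrow> (\<forall>x. 0 \<le> f x) \<and> (\<exists>x. f x \<noteq> 0)"

definition formal_domain :: "('a \<Rightarrow> 'a \<Rightarrow> real) \<Rightarrow> ('a \<Rightarrow> real) set" where
  "formal_domain b = {f. \<forall>x. (\<lambda>y. b x y * \<bar>f y\<bar>) summable_on UNIV}"

text \<open>The operators \<open>L\<close> and \<open>H = L + q\<close> are only meaningful on \<open>formal_domain b\<close>.\<close>

definition laplacian :: "('a \<Rightarrow> 'a \<Rightarrow> real) \<Rightarrow> ('a \<Rightarrow> real) \<Rightarrow> 'a \<Rightarrow> real" where
  "laplacian b f x = (\<Sum>\<^sub>\<infinity>y. b x y * (f x - f y))"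

definition schroedinger ::
    "('a \<Rightarrow> 'a \<Rightarrow> real) \<Rightarrow> ('a \<Rightarrow> real) \<Rightarrow> ('a \<Rightarrow> real) \<Rightarrow> 'a \<Rightarrow> real" where
  "schroedinger b q f x = laplacian b f x + q x * f x"

definition potential_form :: "('a \<Rightarrow> real) \<Rightarrow> ('a \<Rightarrow> real) \<Rightarrow> real" where
  "potential_form w \<phi> = (\<Sum>\<^sub>\<infinity>x. w x * (\<phi> x)\<^sup>2)"

definition schroedinger_form ::
    "('a \<Rightarrow> 'a \<Rightarrow> real) \<Rightarrow> ('a \<Rightarrow> real) \<Rightarrow> ('a \<Rightarrow> real) \<Rightarrow> real" where
  "schroedinger_form b q \<phi> =
     1/2 * (\<Sum>\<^sub>\<infinity>(x, y). b x y * (\<phi> x - \<phi> y)\<^sup>2) + potential_form q \<phi>"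

definition superharmonic_on ::
    "('a \<Rightarrow> 'a \<Rightarrow> real) \<Rightarrow> ('a \<Rightarrow> real) \<Rightarrow> 'a set \<Rightarrow> ('a \<Rightarrow> real) \<Rightarrow> bool" where
  "superharmonic_on b q W u \<longleftrightarrow>
     u \<in> formal_domain b \<and> (\<forall>x\<in>W. schroedinger b q u x \<ge> 0)"

definition harmonic_on ::
    "('a \<Rightarrow> 'a \<Rightarrow> real) \<Rightarrow> ('a \<Rightarrow> real) \<Rightarrow> 'a set \<Rightarrow> ('a \<Rightarrow> real) \<Rightarrow> bool" where
  "harmonic_on b q W u \<longleftrightarrow>
     u \<in> formal_domain b \<and> (\<forall>x\<in>W. schroedinger b q u x = 0)"

text \<open>Properness of a map into \<open>(0,\<infinity>)\<close>, where the domain is discrete.\<close>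

definition proper_pos :: "('a \<Rightarrow> real) \<Rightarrow> bool" where
  "proper_pos f \<longleftrightarrow> (\<forall>I. compact I \<and> I \<subseteq> {0<..} \<longrightarrow> finite (f -` I))"

definition form_nonneg_on :: "'a set \<Rightarrow> (('a \<Rightarrow> real) \<Rightarrow> real) \<Rightarrow> bool" where
  "form_nonneg_on W Q \<longleftrightarrow> (\<forall>\<phi>\<in>Cc W. Q \<phi> \<ge> 0)"

definition critical_form :: "(('a \<Rightarrow> real) \<Rightarrow> real) \<Rightarrow> bool" where
  "critical_form Q \<longleftrightarrow>
     \<not> (\<exists>w'. positive_fun w' \<and> form_nonneg_on UNIV (\<lambda>\<phi>. Q \<phi> - potential_form w' \<phi>))"

text \<open>
  A ground state of \<open>h - w\<close> is a positive superharmonic function of \<open>H - w = L + (q - w)\<close>.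
  For critical forms it exists and is unique up to multiples. Null-criticality
  below therefore asks for existence and for divergence of the sum for every ground state.
\<close>

definition ground_state ::
    "('a \<Rightarrow> 'a \<Rightarrow> real) \<Rightarrow> ('a \<Rightarrow> real) \<Rightarrow> ('a \<Rightarrow> real) \<Rightarrow> ('a \<Rightarrow> real) \<Rightarrow> bool" where
  "ground_state b q w \<psi> \<longleftrightarrow>
     positive_fun \<psi> \<and> superharmonic_on b (\<lambda>x. q x - w x) UNIV \<psi>"

definition critical ::
    "('a \<Rightarrow> 'a \<Rightarrow> real) \<Rightarrow> ('a \<Rightarrow> real) \<Rightarrow> ('a \<Rightarrow> real) \<Rightarrow> bool" where
  "critical b q w \<longleftrightarrow> critical_form (\<lambda>\<phi>. schroedinger_form b q \<phi> - potential_form w \<phi>)"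

text \<open>Here \<open>w \<ge> 0\<close>, so \<open>\<not> summable_on\<close> says that the sum equals \<open>\<infinity>\<close>.\<close>

definition null_critical ::
    "('a \<Rightarrow> 'a \<Rightarrow> real) \<Rightarrow> ('a \<Rightarrow> real) \<Rightarrow> ('a \<Rightarrow> real) \<Rightarrow> bool" where
  "null_critical b q w \<longleftrightarrow>
     critical b q w \<and> (\<exists>\<psi>. ground_state b q w \<psi>) \<and>
     (\<forall>\<psi>. ground_state b q w \<psi> \<longrightarrow> \<not> (\<lambda>x. (\<psi> x)\<^sup>2 * w x) summable_on UNIV)"

definition optimal_near_infinity ::
    "('a \<Rightarrow> 'a \<Rightarrow> real) \<Rightarrow> ('a \<Rightarrow> real) \<Rightarrow> ('a \<Rightarrow> real) \<Rightarrow> bool" where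
  "optimal_near_infinity b q w \<longleftrightarrow>
     (\<forall>l>0. \<forall>W. finite W \<longrightarrow>
        \<not> (\<forall>\<phi>\<in>Cc (UNIV - W).
             schroedinger_form b q \<phi> - potential_form w \<phi> \<ge> l * potential_form w \<phi>))"

definition optimal_Hardy_weight ::
    "('a \<Rightarrow> 'a \<Rightarrow> real) \<Rightarrow> ('a \<Rightarrow> real) \<Rightarrow> ('a \<Rightarrow> real) \<Rightarrow> bool" where
  "optimal_Hardy_weight b q w \<longleftrightarrow>
     positive_fun w \<and>
     form_nonneg_on UNIV (\<lambda>\<phi>. schroedinger_form b q \<phi> - potential_form w \<phi>) \<and>
     critical b q w \<and> null_critical b q w \<and> optimal_near_infinity b q w"

end

theory Submission imports Defs begin

text \<open>
  Properness of \<open>u0 = u / v\<close> and the bound on \<open>u0 x / u0 y\<close> along edges force the graph to be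
  locally finite, so that all sums below are finite. The function \<open>\<psi> = sqrt (u v)\<close> is
  \<open>(H - w)\<close>-harmonic by the choice of \<open>w\<close>, and the ground state transform turns \<open>h - w\<close> into the
  energy \<open>1/2 \<Sum> b x y \<psi> x \<psi> y (f x - f y)^2\<close>. For logarithmic cutoffs \<open>e\<close> of \<open>u0\<close> at scale \<open>M\<close> this
  energy is at most a constant over \<open>M^2\<close> times the flux
  \<open>\<Sum> b x y (u x v y - u y v x) (G x - G y)\<close>, where \<open>G\<close> is \<open>log u0\<close> truncated at \<open>\<plusminus> 2M\<close>. The flux
  grows only linearly in \<open>M\<close>, since through each level set of \<open>u0\<close> it changes only at the finitely
  many sources. Hence the energy tends to \<open>0\<close>, which gives criticality and uniqueness of the
  ground state. The same flux grows at least linearly near infinity and is bounded by a multiple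
  of \<open>\<Sum> \<psi>^2 w\<close>, which is therefore infinite. Optimality near infinity follows by testing with
  \<open>\<psi> (e - 1_W)\<close>, whose energy stays bounded.
\<close>

section \<open>Forms on locally finite graphs\<close>

lemma potential_form_finite:
  assumes "finite S" "\<And>x. x \<notin> S \<Longrightarrow> f x = 0"
  shows "potential_form w f = (\<Sum>x\<in>S. w x * (f x)\<^sup>2)"
proof -
  have "potential_form w f = (\<Sum>\<^sub>\<infinity>x\<in>S. w x * (f x)\<^sup>2)"
    unfolding potential_form_def by (rule infsum_cong_neutral) (use assms in auto)
  then show ?thesis using assms by simp
qed

text \<open>At a zero \<open>x\<close> of \<open>f\<close> the potential term drops out and the
  operator equals \<open>- \<Sum> b x y * f y\<close>. Nonnegativity then forces \<open>f\<close> to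
  vanish at all neighbours, and connectedness spreads the zero to every vertex.\<close>

lemma superharmonic_positive_pos:
  assumes g: "is_graph b" and conn: "connected_graph b"
    and pos: "positive_fun f" and sup: "superharmonic_on b p UNIV f"
  shows "f x > 0"
proof (rule ccontr)
  have f0: "0 \<le> f y" and b0: "0 \<le> b y z" for y z
    using pos g by (auto simp: positive_fun_def is_graph_def)
  have nb: "f y = 0" if "f x = 0" "adj b x y" for x y
  proof -
    have S: "(\<lambda>y. b x y * f y) summable_on UNIV"
      using sup f0 by (simp add: superharmonic_on_def formal_domain_def)
    have "0 \<le> schroedinger b p f x" using sup by (simp add: superharmonic_on_def)
    also have "\<dots> = - (\<Sum>\<^sub>\<infinity>y. b x y * f y)"
      using that by (simp add: schroedinger_def laplacian_def infsum_uminus)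
    finally have "b x y * f y = 0"
      by (intro nonneg_infsum_le_0D[where A = UNIV and f = "\<lambda>y. b x y * f y"])
        (use S f0 b0 in auto)
    with that show ?thesis by (simp add: adj_def)
  qed
  assume "\<not> f x > 0"
  then have fx: "f x = 0" using f0[of x] by simp
  have "f y = 0" for y
  proof -
    have "(adj b)\<^sup>*\<^sup>* x y" using conn by (simp add: connected_graph_def)
    then show ?thesis by (induction) (use fx nb in auto)
  qed
  then show False using pos by (simp add: positive_fun_def)
qed

text \<open>Discrete summation by parts: exchanging \<open>x\<close> and \<open>y\<close> turns the
  \<open>G y\<close> half of the sum into the \<open>G x\<close> half. It serves both the ground
  state transform and the flux.\<close>

lemma sum_antisymmetric:
  fixes d :: "'a \<Rightarrow> 'a \<Rightarrow> real"
  assumes "\<And>x y. d y x = - d x y"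
  shows "(\<Sum>(x, y)\<in>S \<times> S. d x y * (G x - G y)) = 2 * (\<Sum>x\<in>S. G x * (\<Sum>y\<in>S. d x y))"
proof -
  have "(\<Sum>x\<in>S. \<Sum>y\<in>S. d x y * G y) = (\<Sum>y\<in>S. \<Sum>x\<in>S. d x y * G y)"
    by (rule sum.swap)
  also have "\<dots> = (\<Sum>y\<in>S. \<Sum>x\<in>S. - (G y * d y x))"
    using assms by (intro sum.cong refl) (metis mult.commute mult_minus_left)
  also have "\<dots> = - (\<Sum>x\<in>S. G x * (\<Sum>y\<in>S. d x y))"
    by (simp add: sum_negf sum_distrib_left)
  finally have 1: "(\<Sum>x\<in>S. \<Sum>y\<in>S. d x y * G y) = - (\<Sum>x\<in>S. G x * (\<Sum>y\<in>S. d x y))" .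
  have "(\<Sum>(x, y)\<in>S \<times> S. d x y * (G x - G y))
    = (\<Sum>x\<in>S. \<Sum>y\<in>S. G x * d x y) - (\<Sum>x\<in>S. \<Sum>y\<in>S. d x y * G y)"
    by (simp add: sum.cartesian_product[symmetric] algebra_simps sum_subtractf)
  then show ?thesis by (simp add: 1 sum_distrib_left)
qed

section \<open>Finite sums and the ground state transform on locally finite graphs\<close>

locale locally_finite_graph =
  fixes b :: "'a \<Rightarrow> 'a \<Rightarrow> real"
  assumes graph: "is_graph b"
    and finite_neighbours: "finite {y. b x y \<noteq> 0}"
begin

lemma b_nonneg: "0 \<le> b x y" and b_sym: "b x y = b y x"
  using graph by (auto simp: is_graph_def)

lemma in_formal_domain: "f \<in> formal_domain b"
proof -
  have "(\<lambda>y. b x y * \<bar>f y\<bar>) summable_on UNIV" for x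
    using summable_on_cong_neutral[of "{y. b x y \<noteq> 0}" UNIV "\<lambda>y. b x y * \<bar>f y\<bar>" "\<lambda>y. b x y * \<bar>f y\<bar>"]
      finite_neighbours[of x] by (auto simp: summable_on_finite)
  then show ?thesis by (simp add: formal_domain_def)
qed

lemma laplacian_finite:
  assumes "finite S" "\<And>y. b x y \<noteq> 0 \<Longrightarrow> y \<in> S"
  shows "laplacian b f x = (\<Sum>y\<in>S. b x y * (f x - f y))"
proof -
  have "laplacian b f x = (\<Sum>\<^sub>\<infinity>y\<in>S. b x y * (f x - f y))"
    unfolding laplacian_def by (rule infsum_cong_neutral) (use assms in auto)
  then show ?thesis using assms by simp
qed

lemma ex_finite_neighbourhood:
  assumes "finite A"
  obtains S where "finite S" "A \<subseteq> S" "\<And>x y. x \<in> A \<Longrightarrow> b x y \<noteq> 0 \<Longrightarrow> y \<in> S"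
proof
  show "finite (A \<union> (\<Union>x\<in>A. {y. b x y \<noteq> 0}))"
    using assms finite_neighbours by blast
qed auto

text \<open>\<open>A\<close> contains the support of \<open>f\<close> and \<open>S\<close> also the
  neighbours of \<open>A\<close>, so by symmetry of \<open>b\<close> every contributing pair lies in
  \<open>S \<times> S\<close>.\<close>

lemma schroedinger_form_finite:
  assumes "finite S" "A \<subseteq> S" "\<And>x y. x \<in> A \<Longrightarrow> b x y \<noteq> 0 \<Longrightarrow> y \<in> S"
    "\<And>x. x \<notin> A \<Longrightarrow> f x = 0"
  shows "schroedinger_form b p f
    = 1/2 * (\<Sum>(x, y)\<in>S \<times> S. b x y * (f x - f y)\<^sup>2) + (\<Sum>x\<in>S. p x * (f x)\<^sup>2)"
proof -
  have nz: "x \<in> S \<and> y \<in> S" if "b x y \<noteq> 0" "f x \<noteq> f y" for x y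
    using that assms(2-4) b_sym[of x y] by (metis in_mono)
  have "(\<Sum>\<^sub>\<infinity>(x, y). b x y * (f x - f y)\<^sup>2) = (\<Sum>\<^sub>\<infinity>(x, y)\<in>S \<times> S. b x y * (f x - f y)\<^sup>2)"
    by (intro infsum_cong_neutral) (auto dest: nz)
  moreover have "potential_form p f = (\<Sum>x\<in>S. p x * (f x)\<^sup>2)"
    using assms by (intro potential_form_finite) auto
  ultimately show ?thesis using assms(1) by (simp add: schroedinger_form_def)
qed

lemma form_minus_potential:
  assumes "finite {x. f x \<noteq> 0}"
  shows "schroedinger_form b p f - potential_form w f = schroedinger_form b (\<lambda>x. p x - w x) f"
proof -
  have "potential_form r f = (\<Sum>x | f x \<noteq> 0. r x * (f x)\<^sup>2)" for r
    using assms by (intro potential_form_finite) auto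
  then show ?thesis by (simp add: schroedinger_form_def algebra_simps sum_subtractf)
qed

text \<open>The square splits pointwise into the weighted energy of \<open>f\<close> and a product
  of differences; summation by parts turns the latter into the Laplacian of \<open>\<psi>\<close>.
  The identity is purely algebraic, so it applies to the harmonic \<open>\<psi>\<close> as well as
  to an arbitrary positive superharmonic function.\<close>

lemma ground_state_representation:
  assumes fin: "finite S" and AS: "A \<subseteq> S"
    and nb: "\<And>x y. x \<in> A \<Longrightarrow> b x y \<noteq> 0 \<Longrightarrow> y \<in> S"
    and f0: "\<And>x. x \<notin> A \<Longrightarrow> f x = 0"
  shows "schroedinger_form b p (\<lambda>x. \<psi> x * f x)
    = 1/2 * (\<Sum>(x, y)\<in>S \<times> S. b x y * (\<psi> x * \<psi> y * (f x - f y)\<^sup>2))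
      + (\<Sum>x\<in>S. \<psi> x * schroedinger b p \<psi> x * (f x)\<^sup>2)"
proof -
  have pt: "b x y * (\<psi> x * f x - \<psi> y * f y)\<^sup>2 = b x y * (\<psi> x * \<psi> y * (f x - f y)\<^sup>2)
      + b x y * (\<psi> x - \<psi> y) * (\<psi> x * (f x)\<^sup>2 - \<psi> y * (f y)\<^sup>2)" for x y
    by (simp add: power2_eq_square algebra_simps)
  have "(\<Sum>(x, y)\<in>S \<times> S. b x y * (\<psi> x * f x - \<psi> y * f y)\<^sup>2)
    = (\<Sum>(x, y)\<in>S \<times> S. b x y * (\<psi> x * \<psi> y * (f x - f y)\<^sup>2))
      + (\<Sum>(x, y)\<in>S \<times> S. b x y * (\<psi> x - \<psi> y) * (\<psi> x * (f x)\<^sup>2 - \<psi> y * (f y)\<^sup>2))"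
    unfolding pt by (simp add: sum.distrib split_def)
  also have "(\<Sum>(x, y)\<in>S \<times> S. b x y * (\<psi> x - \<psi> y) * (\<psi> x * (f x)\<^sup>2 - \<psi> y * (f y)\<^sup>2))
    = 2 * (\<Sum>x\<in>S. \<psi> x * (f x)\<^sup>2 * (\<Sum>y\<in>S. b x y * (\<psi> x - \<psi> y)))"
    by (rule sum_antisymmetric) (simp add: b_sym algebra_simps)
  also have "(\<Sum>x\<in>S. \<psi> x * (f x)\<^sup>2 * (\<Sum>y\<in>S. b x y * (\<psi> x - \<psi> y)))
    = (\<Sum>x\<in>S. \<psi> x * (f x)\<^sup>2 * laplacian b \<psi> x)"
  proof (rule sum.cong[OF refl])
    fix x assume "x \<in> S"
    show "\<psi> x * (f x)\<^sup>2 * (\<Sum>y\<in>S. b x y * (\<psi> x - \<psi> y)) = \<psi> x * (f x)\<^sup>2 * laplacian b \<psi> x"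
      by (cases "x \<in> A") (use laplacian_finite[OF fin nb] f0 in auto)
  qed
  finally have "schroedinger_form b p (\<lambda>x. \<psi> x * f x)
    = 1/2 * (\<Sum>(x, y)\<in>S \<times> S. b x y * (\<psi> x * \<psi> y * (f x - f y)\<^sup>2))
      + ((\<Sum>x\<in>S. \<psi> x * (f x)\<^sup>2 * laplacian b \<psi> x) + (\<Sum>x\<in>S. p x * (\<psi> x * f x)\<^sup>2))"
    by (subst schroedinger_form_finite[OF fin AS nb]) (auto simp: f0)
  then show ?thesis
    by (simp add: sum.distrib[symmetric] schroedinger_def algebra_simps power2_eq_square)
qed

end

section \<open>Criticality\<close>

text \<open>\<open>cutoff\<close> encodes a null sequence: functions \<open>\<psi> * e\<close> that
  agree with \<open>\<psi>\<close> on any prescribed finite set and have arbitrarily small energy.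
  Criticality, uniqueness of the ground state and optimality near infinity are derived from this
  alone.\<close>

locale null_sequence = locally_finite_graph b for b :: "'a \<Rightarrow> 'a \<Rightarrow> real" +
  fixes p \<psi> :: "'a \<Rightarrow> real"
  assumes connected: "connected_graph b"
    and \<psi>_pos: "\<psi> x > 0"
    and \<psi>_harmonic: "schroedinger b p \<psi> x = 0"
    and cutoff: "finite A \<Longrightarrow> \<epsilon> > 0 \<Longrightarrow> \<exists>e. finite {x. e x \<noteq> 0} \<and> (\<forall>x\<in>A. e x = 1) \<and>
      schroedinger_form b p (\<lambda>x. \<psi> x * e x) < \<epsilon>"
begin

text \<open>The transform applied to \<open>f / \<psi>\<close> leaves only the energy part, because
  \<open>\<psi>\<close> is harmonic.\<close>

lemma form_nonneg:
  assumes "finite {x. f x \<noteq> 0}"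
  shows "schroedinger_form b p f \<ge> 0"
proof -
  obtain S where S: "finite S" "{x. f x \<noteq> 0} \<subseteq> S" "\<And>x y. x \<in> {x. f x \<noteq> 0} \<Longrightarrow> b x y \<noteq> 0 \<Longrightarrow> y \<in> S"
    using ex_finite_neighbourhood[OF assms] by metis
  have "f = (\<lambda>x. \<psi> x * (f x / \<psi> x))" using \<psi>_pos by (auto simp: less_le)
  then have "schroedinger_form b p f = schroedinger_form b p (\<lambda>x. \<psi> x * (f x / \<psi> x))" by simp
  also have "\<dots> = 1/2 * (\<Sum>(x, y)\<in>S \<times> S. b x y * (\<psi> x * \<psi> y * (f x / \<psi> x - f y / \<psi> y)\<^sup>2))"
    by (subst ground_state_representation[OF S]) (auto simp: \<psi>_harmonic)
  also have "\<dots> \<ge> 0"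
    by (auto intro!: sum_nonneg mult_nonneg_nonneg simp: b_nonneg less_imp_le[OF \<psi>_pos])
  finally show ?thesis .
qed

text \<open>Parallelogram identity, in which the form of \<open>f + g\<close> is dropped by
  \<open>form_nonneg\<close>.\<close>

lemma form_diff_le:
  assumes "finite {x. f x \<noteq> 0}" "finite {x. g x \<noteq> 0}"
  shows "schroedinger_form b p (\<lambda>x. f x - g x)
    \<le> 2 * schroedinger_form b p f + 2 * schroedinger_form b p g"
proof -
  let ?A = "{x. f x \<noteq> 0} \<union> {x. g x \<noteq> 0}"
  have "finite ?A" using assms by simp
  then obtain S where S: "finite S" "?A \<subseteq> S" "\<And>x y. x \<in> ?A \<Longrightarrow> b x y \<noteq> 0 \<Longrightarrow> y \<in> S"
    using ex_finite_neighbourhood by metis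
  let ?D = "\<lambda>k. \<Sum>(x, y)\<in>S \<times> S. b x y * (k x - k y)\<^sup>2" and ?V = "\<lambda>k. \<Sum>x\<in>S. p x * (k x)\<^sup>2"
  have form: "schroedinger_form b p k = 1/2 * ?D k + ?V k" if "\<And>x. x \<notin> ?A \<Longrightarrow> k x = 0" for k
    by (rule schroedinger_form_finite[OF S that])
  have "?D (\<lambda>x. f x - g x) + ?D (\<lambda>x. f x + g x) = 2 * ?D f + 2 * ?D g"
    unfolding sum.distrib[symmetric] sum_distrib_left split_def
    by (intro sum.cong refl) (simp add: power2_eq_square algebra_simps)
  moreover have "?V (\<lambda>x. f x - g x) + ?V (\<lambda>x. f x + g x) = 2 * ?V f + 2 * ?V g"
    unfolding sum.distrib[symmetric] sum_distrib_left
    by (intro sum.cong refl) (simp add: power2_eq_square algebra_simps)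
  moreover have "schroedinger_form b p (\<lambda>x. f x - g x) = 1/2 * ?D (\<lambda>x. f x - g x) + ?V (\<lambda>x. f x - g x)"
    "schroedinger_form b p (\<lambda>x. f x + g x) = 1/2 * ?D (\<lambda>x. f x + g x) + ?V (\<lambda>x. f x + g x)"
    "schroedinger_form b p f = 1/2 * ?D f + ?V f" "schroedinger_form b p g = 1/2 * ?D g + ?V g"
    by (rule form; simp)+
  moreover have "schroedinger_form b p (\<lambda>x. f x + g x) \<ge> 0"
    by (intro form_nonneg finite_subset[OF _ \<open>finite ?A\<close>]) auto
  ultimately show ?thesis by linarith
qed

text \<open>At a vertex with \<open>w' x > 0\<close>, a test function equal to \<open>\<psi>\<close>
  there has \<open>w'\<close>-mass at least \<open>w' x * (\<psi> x)\<^sup>2\<close>, while its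
  energy can be made smaller.\<close>

lemma critical:
  assumes w': "positive_fun w'"
  shows "\<not> form_nonneg_on UNIV (\<lambda>\<phi>. schroedinger_form b p \<phi> - potential_form w' \<phi>)"
proof
  assume nn: "form_nonneg_on UNIV (\<lambda>\<phi>. schroedinger_form b p \<phi> - potential_form w' \<phi>)"
  obtain x where "w' x \<noteq> 0" and w0: "\<And>y. 0 \<le> w' y" using w' by (auto simp: positive_fun_def)
  then have "w' x * (\<psi> x)\<^sup>2 > 0" using \<psi>_pos[of x] by (simp add: less_le)
  then obtain e where e: "finite {x. e x \<noteq> 0}" "e x = 1"
    "schroedinger_form b p (\<lambda>x. \<psi> x * e x) < w' x * (\<psi> x)\<^sup>2"
    using cutoff[of "{x}"] by auto
  have "potential_form w' (\<lambda>x. \<psi> x * e x) = (\<Sum>y | e y \<noteq> 0. w' y * (\<psi> y * e y)\<^sup>2)"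
    using e by (intro potential_form_finite) auto
  also have "\<dots> \<ge> w' x * (\<psi> x * e x)\<^sup>2"
    by (rule member_le_sum) (use e w0 in auto)
  finally have "w' x * (\<psi> x)\<^sup>2 \<le> potential_form w' (\<lambda>x. \<psi> x * e x)" by (simp add: e)
  moreover have "(\<lambda>x. \<psi> x * e x) \<in> Cc UNIV"
    using e(1) by (auto simp: Cc_def elim!: rev_finite_subset)
  ultimately show False using nn e(3) by (force simp: form_nonneg_on_def)
qed

text \<open>The null sequence is transformed with respect to \<open>f\<close> instead of
  \<open>\<psi>\<close>, as \<open>\<psi> * e = f * (r * e)\<close>. Its vanishing energy controls
  every single edge term, so \<open>r = \<psi> / f\<close> is constant along edges.\<close>

lemma superharmonic_unique:
  assumes "positive_fun f" "superharmonic_on b p UNIV f"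
  shows "\<exists>c>0. \<forall>x. f x = c * \<psi> x"
proof -
  have f_pos: "f x > 0" for x
    using superharmonic_positive_pos[OF graph connected assms] .
  have f_sup: "schroedinger b p f x \<ge> 0" for x
    using assms by (simp add: superharmonic_on_def)
  define r where "r = (\<lambda>x. \<psi> x / f x)"
  have edge: "r x = r y" if "adj b x y" for x y
  proof (rule ccontr)
    assume "r x \<noteq> r y"
    have "b x y > 0" using that by (simp add: adj_def)
    \<comment> \<open>Half of the term of the pair \<open>(x, y)\<close> in the transformed energy
      once \<open>e\<close> is \<open>1\<close> at both ends.\<close>
    define \<epsilon> where "\<epsilon> = 1/2 * (b x y * (f x * f y * (r x - r y)\<^sup>2))"
    have "\<epsilon> > 0" using \<open>b x y > 0\<close> \<open>r x \<noteq> r y\<close> f_pos by (simp add: \<epsilon>_def)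
    then obtain e where e: "finite {x. e x \<noteq> 0}" "e x = 1" "e y = 1"
      "schroedinger_form b p (\<lambda>x. \<psi> x * e x) < \<epsilon>"
      using cutoff[of "{x, y}"] by auto
    obtain S where S: "finite S" "{x. e x \<noteq> 0} \<subseteq> S" "\<And>x y. x \<in> {x. e x \<noteq> 0} \<Longrightarrow> b x y \<noteq> 0 \<Longrightarrow> y \<in> S"
      using ex_finite_neighbourhood[OF e(1)] by metis
    have "(\<lambda>x. \<psi> x * e x) = (\<lambda>x. f x * (r x * e x))"
      using f_pos by (auto simp: r_def less_le)
    then have "schroedinger_form b p (\<lambda>x. \<psi> x * e x) = schroedinger_form b p (\<lambda>x. f x * (r x * e x))"
      by simp
    also have "\<dots> = 1/2 * (\<Sum>(x, y)\<in>S \<times> S. b x y * (f x * f y * (r x * e x - r y * e y)\<^sup>2))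
      + (\<Sum>x\<in>S. f x * schroedinger b p f x * (r x * e x)\<^sup>2)"
      by (rule ground_state_representation[OF S]) auto
    \<comment> \<open>The remaining potential part is nonnegative since \<open>f\<close> is
      superharmonic.\<close>
    also have "\<dots> \<ge> 1/2 * (\<Sum>(x, y)\<in>S \<times> S. b x y * (f x * f y * (r x * e x - r y * e y)\<^sup>2))"
      by (auto intro!: sum_nonneg mult_nonneg_nonneg simp: f_sup less_imp_le[OF f_pos])
    finally have "1/2 * (\<Sum>(x, y)\<in>S \<times> S. b x y * (f x * f y * (r x * e x - r y * e y)\<^sup>2)) < \<epsilon>"
      using e(4) by simp
    moreover have "(case (x, y) of (x, y) \<Rightarrow> b x y * (f x * f y * (r x * e x - r y * e y)\<^sup>2))
      \<le> (\<Sum>(x, y)\<in>S \<times> S. b x y * (f x * f y * (r x * e x - r y * e y)\<^sup>2))"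
      by (rule member_le_sum)
        (use S e in \<open>auto simp: b_nonneg less_imp_le[OF f_pos]\<close>)
    ultimately show False using e(2,3) by (simp add: \<epsilon>_def)
  qed
  have const: "r y = r x" for x y
  proof -
    have "(adj b)\<^sup>*\<^sup>* x y" using connected by (simp add: connected_graph_def)
    then show ?thesis by induction (use edge in auto)
  qed
  \<comment> \<open>\<open>undefined\<close> only serves as a base vertex, since \<open>r\<close> is
    constant.\<close>
  define c where "c = 1 / r undefined"
  have "f x = c * \<psi> x" for x
    unfolding c_def const[of undefined x] using f_pos[of x] \<psi>_pos[of x]
    by (simp add: r_def)
  moreover have "c > 0" unfolding c_def r_def using f_pos \<psi>_pos by simp
  ultimately show ?thesis by blast
qed

lemma not_strictly_positive_near_infinity:
  assumes w0: "\<And>x. 0 \<le> w x" and div: "\<not> (\<lambda>x. (\<psi> x)\<^sup>2 * w x) summable_on UNIV"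
    and "l > 0" "finite W"
  shows "\<exists>\<phi>\<in>Cc (UNIV - W). schroedinger_form b p \<phi> < l * potential_form w \<phi>"
proof -
  \<comment> \<open>Twice the energy bound \<open>1\<close> for \<open>\<psi> * e\<close> plus twice
    the energy of \<open>\<psi>\<close> restricted to \<open>W\<close>: a bound for the test
    function that does not depend on \<open>A\<close> below.\<close>
  define B where "B = 2 + 2 * schroedinger_form b p (\<lambda>x. \<psi> x * indicator W x)"
  \<comment> \<open>The mass of \<open>W\<close> is added in advance because the test function
    vanishes on \<open>W\<close>; what remains outside \<open>W\<close> still exceeds
    \<open>B / l\<close>.\<close>
  have "\<exists>A. finite A \<and> (\<Sum>x\<in>A. (\<psi> x)\<^sup>2 * w x) > B / l + (\<Sum>x\<in>W. (\<psi> x)\<^sup>2 * w x)"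
  proof (rule ccontr)
    assume "\<not> ?thesis"
    then have "(\<lambda>x. (\<psi> x)\<^sup>2 * w x) summable_on UNIV"
      by (intro nonneg_bdd_above_summable_on bdd_aboveI2[where M = "B / l + (\<Sum>x\<in>W. (\<psi> x)\<^sup>2 * w x)"])
         (auto simp: w0 not_less)
    with div show False by simp
  qed
  then obtain A where A: "finite A" "(\<Sum>x\<in>A. (\<psi> x)\<^sup>2 * w x) > B / l + (\<Sum>x\<in>W. (\<psi> x)\<^sup>2 * w x)"
    by auto
  obtain e where e: "finite {x. e x \<noteq> 0}" "\<And>x. x \<in> A \<union> W \<Longrightarrow> e x = 1"
    "schroedinger_form b p (\<lambda>x. \<psi> x * e x) < 1"
    using cutoff[of "A \<union> W" 1] A(1) assms(4) by auto
  define \<phi> where "\<phi> = (\<lambda>x. \<psi> x * e x - \<psi> x * indicator W x)"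
  have fin1: "finite {x. \<psi> x * e x \<noteq> 0}" "finite {x. \<psi> x * indicator W x \<noteq> 0}"
    using e(1) assms(4) by (auto simp: indicator_def elim!: rev_finite_subset)
  have supp: "{x. \<phi> x \<noteq> 0} \<subseteq> {x. e x \<noteq> 0}" and \<phi>W: "x \<in> W \<Longrightarrow> \<phi> x = 0" for x
    using e(2) by (auto simp: \<phi>_def indicator_def split: if_splits)
  then have fin\<phi>: "finite {x. \<phi> x \<noteq> 0}" using e(1) finite_subset by blast
  then have "\<phi> \<in> Cc (UNIV - W)" using \<phi>W by (auto simp: Cc_def)
  have "schroedinger_form b p \<phi> < B"
    unfolding \<phi>_def B_def using form_diff_le[OF fin1] e(3) by simp
  also have "B \<le> l * (\<Sum>x\<in>A - W. (\<psi> x)\<^sup>2 * w x)"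
  proof -
    have "(\<Sum>x\<in>A. (\<psi> x)\<^sup>2 * w x) \<le> (\<Sum>x\<in>(A - W) \<union> W. (\<psi> x)\<^sup>2 * w x)"
      by (rule sum_mono2) (use A assms w0 in auto)
    also have "\<dots> = (\<Sum>x\<in>A - W. (\<psi> x)\<^sup>2 * w x) + (\<Sum>x\<in>W. (\<psi> x)\<^sup>2 * w x)"
      by (rule sum.union_disjoint) (use A assms in auto)
    finally have "B / l \<le> (\<Sum>x\<in>A - W. (\<psi> x)\<^sup>2 * w x)" using A by simp
    then show ?thesis using assms(3) by (simp add: field_simps)
  qed
  also have "\<dots> \<le> l * potential_form w \<phi>"
  proof -
    have "(\<Sum>x\<in>A - W. (\<psi> x)\<^sup>2 * w x) = (\<Sum>x\<in>A - W. w x * (\<phi> x)\<^sup>2)"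
      by (rule sum.cong) (use e(2) in \<open>auto simp: \<phi>_def\<close>)
    also have "\<dots> \<le> (\<Sum>x | e x \<noteq> 0. w x * (\<phi> x)\<^sup>2)"
      by (rule sum_mono2) (use e w0 in \<open>auto\<close>)
    also have "\<dots> = potential_form w \<phi>"
      by (rule potential_form_finite[symmetric]) (use e supp in auto)
    finally show ?thesis using assms(3) by simp
  qed
  finally show ?thesis using \<open>\<phi> \<in> Cc (UNIV - W)\<close> by blast
qed

end

section \<open>The flux of the quotient of two superharmonic functions\<close>

definition cutoff_at :: "real \<Rightarrow> real \<Rightarrow> real \<Rightarrow> real" where
  "cutoff_at lo hi t = max lo (min hi t)"

text \<open>Meant for \<open>P = u x * v y\<close> and \<open>Q = u y * v x\<close>, with
  \<open>d\<close> the jump of a truncation of \<open>log (u / v)\<close> along an edge: it has the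
  sign of \<open>ln P - ln Q\<close> and is no larger in modulus. The first bound estimates energy
  by flux, the second estimates flux by the squares that occur in
  \<open>\<psi>\<^sup>2 * w\<close>.\<close>

lemma sqrt_mult_square_le:
  fixes P Q c d :: real
  assumes "P > 0" "Q > 0" "\<bar>ln P - ln Q\<bar> \<le> c"
    and "Q \<le> P \<and> 0 \<le> d \<and> d \<le> ln P - ln Q \<or> P \<le> Q \<and> ln P - ln Q \<le> d \<and> d \<le> 0"
  shows "sqrt (P * Q) * d\<^sup>2 \<le> exp c * ((P - Q) * d)"
    and "(P - Q) * d \<le> 4 * exp c * (sqrt P - sqrt Q)\<^sup>2"
proof -
  \<comment> \<open>The case \<open>Q \<le> P\<close>; the other one follows by exchanging
    \<open>P\<close> and \<open>Q\<close> and replacing \<open>d\<close> by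
    \<open>- d\<close>.\<close>
  have *: "sqrt (P * Q) * d\<^sup>2 \<le> exp c * ((P - Q) * d) \<and> (P - Q) * d \<le> 4 * exp c * (sqrt P - sqrt Q)\<^sup>2"
    if PQ: "P > 0" "Q > 0" "ln P - ln Q \<le> c" "Q \<le> P" "0 \<le> d" "d \<le> ln P - ln Q" for P Q d :: real
  proof
    have "d \<le> (P - Q) / Q" using PQ ln_diff_le[of P Q] by linarith
    then have 1: "Q * d \<le> P - Q" using PQ by (simp add: pos_le_divide_eq mult.commute)
    have "ln P \<le> ln (exp c * Q)" using PQ by (simp add: ln_mult)
    then have 2: "P \<le> exp c * Q" using PQ by simp
    have "sqrt (P * Q) \<le> sqrt (P * P)" using PQ by (intro real_sqrt_le_mono mult_left_mono) auto
    then have "sqrt (P * Q) \<le> exp c * Q" using PQ 2 by simp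
    then have "sqrt (P * Q) * d\<^sup>2 \<le> exp c * Q * d\<^sup>2" by (intro mult_right_mono) auto
    also have "\<dots> = exp c * (Q * d * d)" by (simp add: power2_eq_square)
    also have "\<dots> \<le> exp c * ((P - Q) * d)" using 1 PQ by (intro mult_left_mono mult_right_mono) auto
    finally show "sqrt (P * Q) * d\<^sup>2 \<le> exp c * ((P - Q) * d)" .
    have "Q * ((P - Q) * d) = (P - Q) * (Q * d)" by simp
    also have "\<dots> \<le> (P - Q) * (P - Q)" using 1 PQ by (intro mult_left_mono) auto
    also have "\<dots> = ((sqrt P)\<^sup>2 - (sqrt Q)\<^sup>2) * ((sqrt P)\<^sup>2 - (sqrt Q)\<^sup>2)" using PQ by simp
    also have "\<dots> = (sqrt P - sqrt Q)\<^sup>2 * (sqrt P + sqrt Q)\<^sup>2"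
      by (simp add: power2_eq_square algebra_simps)
    also have "\<dots> \<le> (sqrt P - sqrt Q)\<^sup>2 * (sqrt P + sqrt P)\<^sup>2"
      using PQ by (intro mult_left_mono power_mono) auto
    also have "\<dots> = 4 * (sqrt P - sqrt Q)\<^sup>2 * P" using PQ by (simp add: power2_eq_square)
    also have "\<dots> \<le> 4 * (sqrt P - sqrt Q)\<^sup>2 * (exp c * Q)" using 2 by (intro mult_left_mono) auto
    finally have "Q * ((P - Q) * d) \<le> Q * (4 * exp c * (sqrt P - sqrt Q)\<^sup>2)" by (simp add: mult_ac)
    then show "(P - Q) * d \<le> 4 * exp c * (sqrt P - sqrt Q)\<^sup>2" using PQ by simp
  qed
  have flip: "sqrt (Q * P) * (- d)\<^sup>2 = sqrt (P * Q) * d\<^sup>2" "(Q - P) * (- d) = (P - Q) * d"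
    "(sqrt Q - sqrt P)\<^sup>2 = (sqrt P - sqrt Q)\<^sup>2"
    by (simp_all add: mult.commute power2_commute algebra_simps)
  have "sqrt (P * Q) * d\<^sup>2 \<le> exp c * ((P - Q) * d) \<and> (P - Q) * d \<le> 4 * exp c * (sqrt P - sqrt Q)\<^sup>2"
    using assms(4)
  proof
    assume "Q \<le> P \<and> 0 \<le> d \<and> d \<le> ln P - ln Q"
    then show ?thesis using assms(1-3) by (intro *) auto
  next
    assume "P \<le> Q \<and> ln P - ln Q \<le> d \<and> d \<le> 0"
    then show ?thesis using assms(1-3) *[of Q P "- d"] unfolding flip by auto
  qed
  then show "sqrt (P * Q) * d\<^sup>2 \<le> exp c * ((P - Q) * d)"
    and "(P - Q) * d \<le> 4 * exp c * (sqrt P - sqrt Q)\<^sup>2" by auto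
qed

lemma cutoff_log_diff:
  assumes "P > 0" "Q > 0" "ln P - ln Q = s - t"
  shows "Q \<le> P \<and> 0 \<le> cutoff_at lo hi s - cutoff_at lo hi t \<and> cutoff_at lo hi s - cutoff_at lo hi t \<le> ln P - ln Q \<or>
    P \<le> Q \<and> ln P - ln Q \<le> cutoff_at lo hi s - cutoff_at lo hi t \<and> cutoff_at lo hi s - cutoff_at lo hi t \<le> 0"
proof (cases "t \<le> s")
  case True
  then have "Q \<le> P" using assms ln_less_cancel_iff[of P Q] by linarith
  then show ?thesis using True assms by (auto simp: cutoff_at_def)
next
  case False
  then have "P \<le> Q" using assms ln_less_cancel_iff[of Q P] by linarith
  then show ?thesis using False assms by (auto simp: cutoff_at_def)
qed

text \<open>The two assumptions on \<open>u / v\<close> in logarithmic form: jumps along edges are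
  at most \<open>c\<close>, and level slabs are finite. Exchanging \<open>u\<close> and
  \<open>v\<close> only flips the sign of the logarithm, so the locale can be reinterpreted with the
  roles reversed.\<close>

locale hardy_pair = locally_finite_graph b for b :: "'a \<Rightarrow> 'a \<Rightarrow> real" +
  fixes q u v :: "'a \<Rightarrow> real" and c :: real
  assumes infinite_vertices: "infinite (UNIV :: 'a set)"
    and connected: "connected_graph b"
    and u_pos: "u x > 0" and v_pos: "v x > 0"
    and u_super: "schroedinger b q u x \<ge> 0" and v_super: "schroedinger b q v x \<ge> 0"
    and finite_sources: "finite {x. schroedinger b q u x \<noteq> 0 \<or> schroedinger b q v x \<noteq> 0}"
    and edge_bound: "b x y \<noteq> 0 \<Longrightarrow> (ln (u x) - ln (v x)) - (ln (u y) - ln (v y)) \<le> c"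
    and finite_level: "finite {x. lo \<le> ln (u x) - ln (v x) \<and> ln (u x) - ln (v x) \<le> hi}"
begin

definition log_quot :: "'a \<Rightarrow> real" where "log_quot x = ln (u x) - ln (v x)"

definition slab :: "real \<Rightarrow> real \<Rightarrow> 'a set" where "slab lo hi = {x. lo \<le> log_quot x \<and> log_quot x \<le> hi}"

text \<open>After the ground state transform with \<open>v\<close>, the Laplacian of \<open>u / v\<close>.\<close>

definition source :: "'a \<Rightarrow> real" where
  "source x = v x * schroedinger b q u x - u x * schroedinger b q v x"

text \<open>The antisymmetric current \<open>b x y * (u x * v y - u y * v x)\<close> paired with the
  gradient of \<open>G\<close>; each edge is counted in both directions.\<close>

definition flux :: "'a set \<Rightarrow> ('a \<Rightarrow> real) \<Rightarrow> real" where
  "flux S G = (\<Sum>(x, y)\<in>S \<times> S. b x y * (u x * v y - u y * v x) * (G x - G y))"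

lemma finite_slab: "finite (slab lo hi)"
  using finite_level by (simp add: slab_def log_quot_def)

lemma edge: "b x y \<noteq> 0 \<Longrightarrow> \<bar>log_quot x - log_quot y\<bar> \<le> c"
  using edge_bound[of x y] edge_bound[of y x] by (simp add: b_sym log_quot_def abs_le_iff)

lemma slab_neighbour: "x \<in> slab lo hi \<Longrightarrow> b x y \<noteq> 0 \<Longrightarrow> y \<in> slab (lo - c) (hi + c)"
  using edge[of x y] by (simp add: slab_def abs_le_iff)

lemma c_nonneg: "0 \<le> c"
proof -
  obtain x y :: 'a where "x \<noteq> y"
    using infinite_vertices by (metis finite.emptyI finite_insert finite_subset insertI1 subsetI)
  moreover have "(adj b)\<^sup>*\<^sup>* x y" using connected by (simp add: connected_graph_def)
  ultimately obtain z where "adj b x z" by (metis converse_rtranclpE)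
  then show ?thesis using edge[of x z] by (simp add: adj_def)
qed

text \<open>Green's formula: the divergence of the current at \<open>x\<close> is
  \<open>source x\<close>, because the potential terms cancel in
  \<open>v * H u - u * H v\<close>.\<close>

lemma flux_finite_support:
  assumes fin: "finite S" and nb: "\<And>x y. x \<in> A \<Longrightarrow> b x y \<noteq> 0 \<Longrightarrow> y \<in> S"
    and G0: "\<And>x. x \<notin> A \<Longrightarrow> G x = 0"
  shows "flux S G = 2 * (\<Sum>x\<in>S. G x * source x)"
proof -
  have "flux S G = 2 * (\<Sum>x\<in>S. G x * (\<Sum>y\<in>S. b x y * (u x * v y - u y * v x)))"
    unfolding flux_def by (rule sum_antisymmetric) (simp add: b_sym algebra_simps)
  also have "(\<Sum>x\<in>S. G x * (\<Sum>y\<in>S. b x y * (u x * v y - u y * v x))) = (\<Sum>x\<in>S. G x * source x)"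
  proof (rule sum.cong[OF refl])
    fix x
    show "G x * (\<Sum>y\<in>S. b x y * (u x * v y - u y * v x)) = G x * source x"
    proof (cases "x \<in> A")
      case True
      have "source x = v x * laplacian b u x - u x * laplacian b v x"
        by (simp add: source_def schroedinger_def algebra_simps)
      also have "\<dots> = (\<Sum>y\<in>S. b x y * (u x * v y - u y * v x))"
        by (simp add: laplacian_finite[OF fin nb[OF True]] sum_distrib_left
            sum_subtractf[symmetric] algebra_simps)
      finally show ?thesis by simp
    qed (simp add: G0)
  qed
  finally show ?thesis .
qed

lemma ln_cross_diff: "ln (u x * v y) - ln (u y * v x) = log_quot x - log_quot y"
  using u_pos v_pos by (simp add: log_quot_def ln_mult less_imp_neq[symmetric])

lemmas edge_cutoff_at = cutoff_log_diff[OF mult_pos_pos[OF u_pos v_pos] mult_pos_pos[OF u_pos v_pos] ln_cross_diff]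

text \<open>Both factors have the sign of \<open>log_quot x - log_quot y\<close>, up to vanishing.
  Hence the flux of a truncation grows with the vertex set.\<close>

lemma flux_term_nonneg:
  "0 \<le> b x y * (u x * v y - u y * v x) * (cutoff_at lo hi (log_quot x) - cutoff_at lo hi (log_quot y))"
proof -
  have "0 \<le> (u x * v y - u y * v x) * (cutoff_at lo hi (log_quot x) - cutoff_at lo hi (log_quot y))"
    using edge_cutoff_at[of x y lo hi] by (auto simp: zero_le_mult_iff)
  then show ?thesis using b_nonneg[of x y] by (simp add: mult.assoc)
qed

lemma flux_mono:
  assumes "finite S'" "S \<subseteq> S'"
  shows "flux S (\<lambda>x. cutoff_at lo hi (log_quot x)) \<le> flux S' (\<lambda>x. cutoff_at lo hi (log_quot x))"
  unfolding flux_def split_def using assms by (intro sum_mono2 flux_term_nonneg) auto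

text \<open>
  Two cutoff functions of \<open>log (u / v)\<close> with the same total rise differ by a finitely supported
  function after adding a constant, so their fluxes differ only by the contribution of the sources.
\<close>

lemma flux_cutoff:
  fixes lo hi a :: real
  defines "T \<equiv> \<lambda>x. cutoff_at lo hi (log_quot x) - (lo + (hi - lo) * (cutoff_at a (a + 1) (log_quot x) - a))"
  assumes "lo \<le> hi" "finite S" "slab (min lo a - c) (max hi (a + 1) + c) \<subseteq> S"
  shows "flux S (\<lambda>x. cutoff_at lo hi (log_quot x))
    = (hi - lo) * flux S (\<lambda>x. cutoff_at a (a + 1) (log_quot x)) + 2 * (\<Sum>x\<in>S. T x * source x)"
proof -
  have "flux S T = flux S (\<lambda>x. cutoff_at lo hi (log_quot x)) - (hi - lo) * flux S (\<lambda>x. cutoff_at a (a + 1) (log_quot x))"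
    by (simp add: T_def flux_def sum_distrib_left sum_subtractf[symmetric] split_def algebra_simps)
  moreover have "flux S T = 2 * (\<Sum>x\<in>S. T x * source x)"
  proof (rule flux_finite_support[where A = "slab (min lo a) (max hi (a + 1))"])
    show "T x = 0" if "x \<notin> slab (min lo a) (max hi (a + 1))" for x
    proof -
      \<comment> \<open>Below both windows the two truncations sit at their lower ends, above both
        at their upper ends, and \<open>T\<close> is normalised to vanish in either case.\<close>
      have "log_quot x < lo \<and> log_quot x < a \<or> log_quot x > hi \<and> log_quot x > a + 1"
        using that by (auto simp: slab_def)
      then show ?thesis using \<open>lo \<le> hi\<close> by (auto simp: T_def cutoff_at_def)
    qed
  qed (use assms slab_neighbour in blast)+
  ultimately show ?thesis by simp
qed

lemma flux_unit_bounded: "\<exists>E\<ge>0. \<forall>S. finite S \<longrightarrow> flux S (\<lambda>x. cutoff_at 0 1 (log_quot x)) \<le> E"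
proof (intro exI[of _ "flux (slab (- c) (1 + c)) (\<lambda>x. cutoff_at 0 1 (log_quot x))"] conjI allI impI)
  let ?f = "\<lambda>x y. b x y * (u x * v y - u y * v x) * (cutoff_at 0 1 (log_quot x) - cutoff_at 0 1 (log_quot y))"
  let ?S = "slab (- c) (1 + c)"
  show "0 \<le> flux ?S (\<lambda>x. cutoff_at 0 1 (log_quot x))"
    unfolding flux_def split_def by (intro sum_nonneg flux_term_nonneg)
  fix S :: "'a set" assume "finite S"
  \<comment> \<open>If the truncated values at the ends of an edge differ, the ends are neither both
    at most \<open>0\<close> nor both at least \<open>1\<close>, so each is within \<open>c\<close>
    of the unit window.\<close>
  have zero: "x \<in> ?S \<and> y \<in> ?S" if "?f x y \<noteq> 0" for x y
  proof -
    have "\<bar>log_quot x - log_quot y\<bar> \<le> c" using that by (intro edge) simp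
    moreover have "cutoff_at 0 1 (log_quot x) \<noteq> cutoff_at 0 1 (log_quot y)" using that by simp
    ultimately show ?thesis by (auto simp: slab_def cutoff_at_def)
  qed
  have "flux S (\<lambda>x. cutoff_at 0 1 (log_quot x)) \<le> flux (S \<union> ?S) (\<lambda>x. cutoff_at 0 1 (log_quot x))"
    using \<open>finite S\<close> finite_slab by (intro flux_mono) auto
  also have "\<dots> = flux ?S (\<lambda>x. cutoff_at 0 1 (log_quot x))"
    unfolding flux_def
  proof (rule sum.mono_neutral_right)
    show "\<forall>p\<in>(S \<union> ?S) \<times> (S \<union> ?S) - ?S \<times> ?S. (case p of (x, y) \<Rightarrow> ?f x y) = 0"
    proof
      fix p assume "p \<in> (S \<union> ?S) \<times> (S \<union> ?S) - ?S \<times> ?S"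
      moreover obtain x y where p: "p = (x, y)" by (cases p)
      ultimately have "?f x y = 0" using zero[of x y] by blast
      then show "(case p of (x, y) \<Rightarrow> ?f x y) = 0" unfolding p by (simp only: prod.case)
    qed
  qed (use \<open>finite S\<close> finite_slab in auto)
  finally show "flux S (\<lambda>x. cutoff_at 0 1 (log_quot x)) \<le> flux ?S (\<lambda>x. cutoff_at 0 1 (log_quot x))" .
qed

text \<open>The window has total rise \<open>4 * M\<close>, so its flux is \<open>4 * M\<close>
  times the bounded unit flux plus a source term with weights of modulus at most
  \<open>4 * M\<close>.\<close>

lemma flux_linear_bound:
  "\<exists>K\<ge>0. \<forall>M\<ge>1. \<forall>S. finite S \<longrightarrow> flux S (\<lambda>x. cutoff_at (- 2 * M) (2 * M) (log_quot x)) \<le> K * M"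
proof -
  obtain E where E: "E \<ge> 0" "\<And>S. finite S \<Longrightarrow> flux S (\<lambda>x. cutoff_at 0 1 (log_quot x)) \<le> E"
    using flux_unit_bounded by auto
  have fin: "finite {x. source x \<noteq> 0}"
    by (rule finite_subset[OF _ finite_sources]) (auto simp: source_def)
  define D where "D = (\<Sum>x | source x \<noteq> 0. \<bar>source x\<bar>)"
  have "flux S (\<lambda>x. cutoff_at (- 2 * M) (2 * M) (log_quot x)) \<le> (4 * E + 8 * D) * M"
    if M: "M \<ge> 1" and S: "finite S" for M S
  proof -
    let ?S = "S \<union> slab (- 2 * M - c) (2 * M + c)"
    \<comment> \<open>The function \<open>T\<close> of \<open>flux_cutoff\<close> for the windows
      \<open>[- 2 * M, 2 * M]\<close> and \<open>[0, 1]\<close>, left unsimplified so that it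
      matches that lemma.\<close>
    define T where
      "T = (\<lambda>x. cutoff_at (- 2 * M) (2 * M) (log_quot x) - (- 2 * M + (2 * M - - 2 * M) * (cutoff_at 0 (0 + 1) (log_quot x) - 0)))"
    have finS: "finite ?S" using S finite_slab by simp
    have T: "\<bar>T x\<bar> \<le> 4 * M" for x
    proof -
      have "- 2 * M \<le> cutoff_at (- 2 * M) (2 * M) (log_quot x)" "cutoff_at (- 2 * M) (2 * M) (log_quot x) \<le> 2 * M"
        using M by (auto simp: cutoff_at_def)
      moreover have "0 \<le> M * cutoff_at 0 1 (log_quot x)" "M * cutoff_at 0 1 (log_quot x) \<le> M"
        using M by (auto simp: cutoff_at_def intro!: mult_left_le)
      ultimately show ?thesis by (simp add: T_def abs_le_iff)
    qed
    have "flux S (\<lambda>x. cutoff_at (- 2 * M) (2 * M) (log_quot x)) \<le> flux ?S (\<lambda>x. cutoff_at (- 2 * M) (2 * M) (log_quot x))"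
      using finS by (intro flux_mono) auto
    also have "\<dots> = (2 * M - - 2 * M) * flux ?S (\<lambda>x. cutoff_at 0 (0 + 1) (log_quot x)) + 2 * (\<Sum>x\<in>?S. T x * source x)"
      unfolding T_def using M finS
      by (intro flux_cutoff) (auto simp: slab_def)
    also have "\<dots> \<le> 4 * M * E + 2 * (4 * M * D)"
    proof (intro add_mono mult_left_mono)
      have "(2 * M - - 2 * M) * flux ?S (\<lambda>x. cutoff_at 0 (0 + 1) (log_quot x)) \<le> (2 * M - - 2 * M) * E"
        using M E(2)[OF finS] by (intro mult_left_mono) auto
      then show "(2 * M - - 2 * M) * flux ?S (\<lambda>x. cutoff_at 0 (0 + 1) (log_quot x)) \<le> 4 * M * E" by simp
      have "(\<Sum>x\<in>?S. T x * source x) = (\<Sum>x\<in>?S \<inter> {x. source x \<noteq> 0}. T x * source x)"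
        using finS by (intro sum.mono_neutral_right) auto
      also have "\<dots> \<le> (\<Sum>x\<in>?S \<inter> {x. source x \<noteq> 0}. 4 * M * \<bar>source x\<bar>)"
      proof (intro sum_mono)
        fix x
        have "T x * source x \<le> \<bar>T x\<bar> * \<bar>source x\<bar>" by (simp add: abs_mult[symmetric])
        also have "\<dots> \<le> 4 * M * \<bar>source x\<bar>" using T by (intro mult_right_mono) auto
        finally show "T x * source x \<le> 4 * M * \<bar>source x\<bar>" .
      qed
      also have "\<dots> \<le> 4 * M * D"
        unfolding D_def sum_distrib_left using M fin by (intro sum_mono2) auto
      finally show "(\<Sum>x\<in>?S. T x * source x) \<le> 4 * M * D" .
    qed auto
    finally show ?thesis by (simp add: algebra_simps)
  qed
  moreover have "4 * E + 8 * D \<ge> 0" using E by (simp add: D_def sum_nonneg)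
  ultimately show ?thesis by (intro exI[of _ "4 * E + 8 * D"]) auto
qed

section \<open>The ground state and the Hardy weight\<close>

definition \<psi> :: "'a \<Rightarrow> real" where "\<psi> x = sqrt (u x * v x)"

definition w :: "'a \<Rightarrow> real" where "w x = schroedinger b q \<psi> x / \<psi> x"

lemma \<psi>_pos: "\<psi> x > 0"
  using u_pos v_pos by (simp add: \<psi>_def)

text \<open>Since \<open>\<psi> x * \<psi> y\<close> is the product of
  \<open>sqrt (u x * v y)\<close> and \<open>sqrt (u y * v x)\<close>, the defect between geometric
  and arithmetic mean appears as half a square.\<close>

lemma \<psi>_schroedinger:
  assumes "finite S" "\<And>y. b x y \<noteq> 0 \<Longrightarrow> y \<in> S"
  shows "\<psi> x * schroedinger b q \<psi> x = 1/2 * (v x * schroedinger b q u x + u x * schroedinger b q v x)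
    + 1/2 * (\<Sum>y\<in>S. b x y * (sqrt (u x * v y) - sqrt (u y * v x))\<^sup>2)"
proof -
  have pos: "0 \<le> u y" "0 \<le> v y" for y using u_pos v_pos by (auto intro: less_imp_le)
  have pt: "\<psi> x * (\<psi> x - \<psi> y) = 1/2 * (v x * (u x - u y)) + 1/2 * (u x * (v x - v y))
    + 1/2 * (sqrt (u x * v y) - sqrt (u y * v x))\<^sup>2" for y
  proof -
    have 1: "\<psi> x * \<psi> y = sqrt (u x * v y) * sqrt (u y * v x)"
      by (simp add: \<psi>_def real_sqrt_mult)
    have 2: "\<psi> x * \<psi> x = u x * v x" "(sqrt (u x * v y))\<^sup>2 = u x * v y" "(sqrt (u y * v x))\<^sup>2 = u y * v x"
      using pos by (auto simp: \<psi>_def)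
    show ?thesis unfolding right_diff_distrib power2_diff 1 2 by (simp add: field_simps)
  qed
  have "\<psi> x * laplacian b \<psi> x = (\<Sum>y\<in>S. b x y * (\<psi> x * (\<psi> x - \<psi> y)))"
    by (simp add: laplacian_finite[OF assms] sum_distrib_left mult_ac)
  also have "\<dots> = 1/2 * (v x * laplacian b u x) + 1/2 * (u x * laplacian b v x)
    + 1/2 * (\<Sum>y\<in>S. b x y * (sqrt (u x * v y) - sqrt (u y * v x))\<^sup>2)"
    unfolding pt by (simp add: laplacian_finite[OF assms] sum_distrib_left sum.distrib[symmetric]
        distrib_left mult_ac)
  finally have "\<psi> x * laplacian b \<psi> x = 1/2 * (v x * laplacian b u x) + 1/2 * (u x * laplacian b v x)
    + 1/2 * (\<Sum>y\<in>S. b x y * (sqrt (u x * v y) - sqrt (u y * v x))\<^sup>2)" .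
  moreover have "\<psi> x * (q x * \<psi> x) = q x * (u x * v x)"
    using pos by (simp add: \<psi>_def)
  ultimately show ?thesis by (simp add: schroedinger_def algebra_simps)
qed

lemma \<psi>_square_w: "(\<psi> x)\<^sup>2 * w x = \<psi> x * schroedinger b q \<psi> x"
  using \<psi>_pos[of x] by (simp add: w_def power2_eq_square)

lemma \<psi>_square_w_ge:
  assumes "finite S"
  shows "(\<psi> x)\<^sup>2 * w x \<ge> 1/2 * (\<Sum>y\<in>S. b x y * (sqrt (u x * v y) - sqrt (u y * v x))\<^sup>2)"
proof -
  let ?S = "S \<union> {y. b x y \<noteq> 0}"
  have fin: "finite ?S" using assms finite_neighbours by simp
  have "0 \<le> v x * schroedinger b q u x + u x * schroedinger b q v x"
    using u_pos[of x] v_pos[of x] u_super[of x] v_super[of x] by simp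
  then have "(\<psi> x)\<^sup>2 * w x \<ge> 1/2 * (\<Sum>y\<in>?S. b x y * (sqrt (u x * v y) - sqrt (u y * v x))\<^sup>2)"
    by (simp add: \<psi>_square_w \<psi>_schroedinger[OF fin])
  moreover have "(\<Sum>y\<in>S. b x y * (sqrt (u x * v y) - sqrt (u y * v x))\<^sup>2)
    \<le> (\<Sum>y\<in>?S. b x y * (sqrt (u x * v y) - sqrt (u y * v x))\<^sup>2)"
    by (rule sum_mono2) (use fin b_nonneg in auto)
  ultimately show ?thesis by simp
qed

lemma w_nonneg: "0 \<le> w x"
  using \<psi>_square_w_ge[of "{}" x] \<psi>_pos[of x] by (simp add: zero_le_mult_iff)

lemma \<psi>_harmonic: "schroedinger b (\<lambda>x. q x - w x) \<psi> x = 0"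
proof -
  have "w x * \<psi> x = schroedinger b q \<psi> x"
    using \<psi>_pos[of x] by (simp add: w_def)
  then show ?thesis by (simp add: schroedinger_def left_diff_distrib)
qed

text \<open>The cutoff \<open>e\<close> has slope at most \<open>1 / M\<close> in
  \<open>log_quot\<close>, and the flux over its window is at most \<open>K * M\<close>; together
  they bound the energy by \<open>exp c * K / (2 * M)\<close>.\<close>

lemma \<psi>_cutoff:
  assumes "finite A" "\<epsilon> > 0"
  shows "\<exists>e. finite {x. e x \<noteq> 0} \<and> (\<forall>x\<in>A. e x = 1) \<and>
    schroedinger_form b (\<lambda>x. q x - w x) (\<lambda>x. \<psi> x * e x) < \<epsilon>"
proof -
  obtain K where K: "K \<ge> 0"
    "\<And>M S. M \<ge> 1 \<Longrightarrow> finite S \<Longrightarrow> flux S (\<lambda>x. cutoff_at (- 2 * M) (2 * M) (log_quot x)) \<le> K * M"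
    using flux_linear_bound by auto
  \<comment> \<open>The sum makes \<open>M\<close> dominate \<open>\<bar>log_quot x\<bar>\<close> on
    \<open>A\<close>, so that \<open>e = 1\<close> there; the last term makes
    \<open>exp c * K / M\<close> smaller than \<open>\<epsilon>\<close>.\<close>
  define M where "M = 1 + (\<Sum>x\<in>A. \<bar>log_quot x\<bar>) + exp c * K / \<epsilon>"
  have Kpos: "exp c * K / \<epsilon> \<ge> 0" using K assms by simp
  have M1: "M \<ge> 1" using Kpos by (simp add: M_def sum_nonneg)
  have MA: "\<bar>log_quot x\<bar> \<le> M" if "x \<in> A" for x
    using member_le_sum[of x A "\<lambda>x. \<bar>log_quot x\<bar>"] that assms Kpos by (simp add: M_def)
  have "M > exp c * K / \<epsilon>" by (simp add: M_def add_pos_nonneg sum_nonneg)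
  then have M\<epsilon>: "exp c * K / M < \<epsilon>" using assms M1 by (simp add: field_simps)
  \<comment> \<open>Equal to \<open>1\<close> where the logarithm has modulus at most
    \<open>M\<close>, linear in between, and \<open>0\<close> from \<open>2 * M\<close> on.\<close>
  define e where "e x = cutoff_at 0 1 (2 - \<bar>log_quot x\<bar> / M)" for x
  let ?A = "slab (- 2 * M) (2 * M)" and ?S = "slab (- 2 * M - c) (2 * M + c)"
  let ?G = "\<lambda>x. cutoff_at (- 2 * M) (2 * M) (log_quot x)"
  have supp: "e x = 0" if "x \<notin> ?A" for x
  proof -
    have "\<bar>log_quot x\<bar> / M \<ge> 2" using that M1 by (auto simp: slab_def field_simps)
    then show ?thesis by (simp add: e_def cutoff_at_def)
  qed
  \<comment> \<open>\<open>e\<close> depends only on the truncated logarithm \<open>?G\<close>, with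
    Lipschitz constant \<open>1 / M\<close>. Passing to \<open>?G\<close> is what brings in the
    flux.\<close>
  have lip: "(e x - e y)\<^sup>2 \<le> (?G x - ?G y)\<^sup>2 / M\<^sup>2" for x y
  proof -
    have e': "e z = cutoff_at 0 1 (2 - \<bar>?G z\<bar> / M)" for z
    proof (cases "z \<in> ?A")
      case True
      then have "?G z = log_quot z" by (simp add: slab_def cutoff_at_def)
      then show ?thesis by (simp add: e_def)
    next
      case False
      then have "\<bar>?G z\<bar> = 2 * M" using M1 by (auto simp: slab_def cutoff_at_def)
      then show ?thesis using supp[OF False] M1 by (simp add: cutoff_at_def)
    qed
    have "\<bar>cutoff_at 0 1 s - cutoff_at 0 1 t\<bar> \<le> \<bar>s - t\<bar>" for s t
      by (auto simp: cutoff_at_def)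
    from this[of "2 - \<bar>?G x\<bar> / M" "2 - \<bar>?G y\<bar> / M"]
    have "\<bar>e x - e y\<bar> \<le> \<bar>\<bar>?G x\<bar> / M - \<bar>?G y\<bar> / M\<bar>"
      unfolding e' by (simp add: abs_minus_commute)
    also have "\<dots> = \<bar>\<bar>?G x\<bar> - \<bar>?G y\<bar>\<bar> / M" using M1 by (simp add: diff_divide_distrib[symmetric])
    also have "\<dots> \<le> \<bar>?G x - ?G y\<bar> / M" using M1 by (intro divide_right_mono) auto
    also have "\<dots> = \<bar>(?G x - ?G y) / M\<bar>" using M1 by simp
    finally have "(e x - e y)\<^sup>2 \<le> ((?G x - ?G y) / M)\<^sup>2" by (simp only: abs_le_square_iff)
    then show ?thesis by (simp add: power_divide)
  qed
  have pt: "b x y * (\<psi> x * \<psi> y * (e x - e y)\<^sup>2)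
    \<le> exp c / M\<^sup>2 * (b x y * (u x * v y - u y * v x) * (?G x - ?G y))" for x y
  proof (cases "b x y = 0")
    case False
    have "\<psi> x * \<psi> y = sqrt ((u x * v y) * (u y * v x))"
      by (simp add: \<psi>_def real_sqrt_mult)
    then have "\<psi> x * \<psi> y * (?G x - ?G y)\<^sup>2 \<le> exp c * ((u x * v y - u y * v x) * (?G x - ?G y))"
      using sqrt_mult_square_le(1)[OF mult_pos_pos[OF u_pos v_pos] mult_pos_pos[OF u_pos v_pos] _ edge_cutoff_at, of x y c]
        edge[OF False] ln_cross_diff by simp
    then have "\<psi> x * \<psi> y * (?G x - ?G y)\<^sup>2 / M\<^sup>2 \<le> exp c * ((u x * v y - u y * v x) * (?G x - ?G y)) / M\<^sup>2"
      by (rule divide_right_mono) simp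
    moreover have "\<psi> x * \<psi> y * (e x - e y)\<^sup>2 \<le> \<psi> x * \<psi> y * ((?G x - ?G y)\<^sup>2 / M\<^sup>2)"
      using \<psi>_pos[of x] \<psi>_pos[of y] lip by (intro mult_left_mono) auto
    ultimately have "\<psi> x * \<psi> y * (e x - e y)\<^sup>2 \<le> exp c * ((u x * v y - u y * v x) * (?G x - ?G y)) / M\<^sup>2"
      by simp
    then show ?thesis
      using mult_left_mono[OF _ b_nonneg[of x y]] by (fastforce simp: mult_ac)
  qed simp
  have "schroedinger_form b (\<lambda>x. q x - w x) (\<lambda>x. \<psi> x * e x)
    = 1/2 * (\<Sum>(x, y)\<in>?S \<times> ?S. b x y * (\<psi> x * \<psi> y * (e x - e y)\<^sup>2))"
    by (subst ground_state_representation[OF finite_slab, where A = ?A])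
      (use c_nonneg supp slab_neighbour in \<open>auto simp: \<psi>_harmonic slab_def\<close>)
  also have "\<dots> \<le> 1/2 * (\<Sum>(x, y)\<in>?S \<times> ?S. exp c / M\<^sup>2 * (b x y * (u x * v y - u y * v x) * (?G x - ?G y)))"
    unfolding split_def by (intro mult_left_mono sum_mono pt) simp
  also have "\<dots> = exp c / (2 * M\<^sup>2) * flux ?S ?G"
    by (simp add: flux_def sum_distrib_left split_def)
  also have "\<dots> \<le> exp c / (2 * M\<^sup>2) * (K * M)"
    by (intro mult_left_mono K M1 finite_slab) auto
  also have "\<dots> = 1/2 * (exp c * K / M)" using M1 by (simp add: power2_eq_square)
  also have "\<dots> < \<epsilon>"
  proof -
    have "1/2 * t < \<epsilon>" if "0 \<le> t" "t < \<epsilon>" for t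
      using that by simp
    from this[OF _ M\<epsilon>] show ?thesis using M1 K(1) by simp
  qed
  finally have "schroedinger_form b (\<lambda>x. q x - w x) (\<lambda>x. \<psi> x * e x) < \<epsilon>" .
  moreover have "finite {x. e x \<noteq> 0}"
    using supp by (intro finite_subset[OF _ finite_slab]) blast
  moreover have "\<forall>x\<in>A. e x = 1"
    using MA M1 by (auto simp: e_def cutoff_at_def max_def min_def divide_le_eq le_diff_eq)
  ultimately show ?thesis by blast
qed

sublocale null_sequence b "\<lambda>x. q x - w x" \<psi>
  by unfold_locales (use connected \<psi>_pos \<psi>_harmonic \<psi>_cutoff in auto)

text \<open>Above all sources the flux through a level set does not depend on the level.\<close>

lemma jump_sum_unbounded_above:
  assumes unb: "\<And>t. \<exists>x. log_quot x > t"
  shows "\<exists>S. finite S \<and> (\<Sum>(x, y)\<in>S \<times> S. b x y * (sqrt (u x * v y) - sqrt (u y * v x))\<^sup>2) > B"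
proof -
  \<comment> \<open>A level at or above \<open>log_quot\<close> of every source and of the base
    vertex \<open>undefined\<close>; a path from that vertex to a higher one must cross it.\<close>
  define a where "a = \<bar>log_quot undefined\<bar> + (\<Sum>x | schroedinger b q u x \<noteq> 0 \<or> schroedinger b q v x \<noteq> 0. \<bar>log_quot x\<bar>)"
  have source0: "source x = 0" if "log_quot x > a" for x
  proof (rule ccontr)
    assume "source x \<noteq> 0"
    then have "\<bar>log_quot x\<bar> \<le> (\<Sum>x | schroedinger b q u x \<noteq> 0 \<or> schroedinger b q v x \<noteq> 0. \<bar>log_quot x\<bar>)"
      by (intro member_le_sum finite_sources) (auto simp: source_def)
    then show False using that by (simp add: a_def)
  qed
  obtain z where z: "log_quot z > a" using unb by blast
  have "(adj b)\<^sup>*\<^sup>* undefined z" using connected by (simp add: connected_graph_def)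
  moreover have "log_quot undefined \<le> a" by (simp add: a_def add_increasing2 sum_nonneg)
  ultimately have "\<exists>x y. adj b x y \<and> log_quot x \<le> a \<and> log_quot y > a"
    using z by induction (auto simp: not_le[symmetric])
  then obtain x y where xy: "b x y > 0" "log_quot x \<le> a" "log_quot y > a" by (auto simp: adj_def)
  \<comment> \<open>The flux carried by one crossing edge: a positive lower bound for the flux
    through the unit window above \<open>a\<close>.\<close>
  define E where "E = flux {x, y} (\<lambda>x. cutoff_at a (a + 1) (log_quot x))"
  have "E > 0"
  proof -
    have "ln (u x * v y) < ln (u y * v x)" using ln_cross_diff[of x y] xy by linarith
    then have "u x * v y < u y * v x"
      using u_pos v_pos by (simp add: ln_less_cancel_iff[of "u x * v y" "u y * v x"])
    moreover have "cutoff_at a (a + 1) (log_quot x) < cutoff_at a (a + 1) (log_quot y)"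
      using xy by (simp add: cutoff_at_def)
    ultimately have "b x y * (u x * v y - u y * v x) * (cutoff_at a (a + 1) (log_quot x) - cutoff_at a (a + 1) (log_quot y)) > 0"
      using xy(1) by (simp add: mult_neg_neg mult.assoc)
    moreover have "(case (x, y) of (x, y) \<Rightarrow> b x y * (u x * v y - u y * v x) * (cutoff_at a (a + 1) (log_quot x) - cutoff_at a (a + 1) (log_quot y))) \<le> E"
      unfolding E_def flux_def by (rule member_le_sum) (auto simp: flux_term_nonneg)
    ultimately show ?thesis unfolding prod.case by (rule less_le_trans)
  qed
  \<comment> \<open>Large enough that \<open>M * E\<close> exceeds
    \<open>4 * exp c * B\<close>.\<close>
  define M where "M = 1 + \<bar>4 * exp c * B\<bar> / E"
  define S where "S = {x, y} \<union> slab (a - c) (a + M + c)"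
  have finS: "finite S" by (simp add: S_def finite_slab)
  have "M \<ge> 1" using \<open>E > 0\<close> by (simp add: M_def)
  have "M * E = E + \<bar>4 * exp c * B\<bar>" using \<open>E > 0\<close> by (simp add: M_def field_simps)
  then have M: "M * E > 4 * exp c * B" using \<open>E > 0\<close> abs_ge_self[of "4 * exp c * B"] by simp
  have "M * E \<le> M * flux S (\<lambda>x. cutoff_at a (a + 1) (log_quot x))"
    unfolding E_def using \<open>M \<ge> 1\<close> finS by (intro mult_left_mono flux_mono) (auto simp: S_def)
  also have "\<dots> = flux S (\<lambda>x. cutoff_at a (a + M) (log_quot x))"
  proof -
    \<comment> \<open>Sources lie at or below \<open>a\<close>, where both truncations equal
      \<open>a\<close>; hence the source term in \<open>flux_cutoff\<close> vanishes and the flux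
      scales exactly by \<open>M\<close>.\<close>
    have "cutoff_at a (a + M) (log_quot x) - (a + (a + M - a) * (cutoff_at a (a + 1) (log_quot x) - a)) = 0 \<or> source x = 0" for x
      using source0[of x] \<open>M \<ge> 1\<close> by (cases "log_quot x > a") (auto simp: cutoff_at_def)
    then have "(\<Sum>x\<in>S. (cutoff_at a (a + M) (log_quot x) - (a + (a + M - a) * (cutoff_at a (a + 1) (log_quot x) - a))) * source x) = 0"
      by (intro sum.neutral) auto
    moreover have "slab (min a a - c) (max (a + M) (a + 1) + c) \<subseteq> S"
      using \<open>M \<ge> 1\<close> by (auto simp: S_def)
    ultimately show ?thesis using flux_cutoff[of a "a + M" S a] finS \<open>M \<ge> 1\<close> by simp
  qed
  also have "\<dots> \<le> (\<Sum>(x, y)\<in>S \<times> S. 4 * exp c * (b x y * (sqrt (u x * v y) - sqrt (u y * v x))\<^sup>2))"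
    unfolding flux_def
  proof (intro sum_mono, clarify)
    fix x y
    show "b x y * (u x * v y - u y * v x) * (cutoff_at a (a + M) (log_quot x) - cutoff_at a (a + M) (log_quot y))
      \<le> 4 * exp c * (b x y * (sqrt (u x * v y) - sqrt (u y * v x))\<^sup>2)"
    proof (cases "b x y = 0")
      case False
      then have "(u x * v y - u y * v x) * (cutoff_at a (a + M) (log_quot x) - cutoff_at a (a + M) (log_quot y))
        \<le> 4 * exp c * (sqrt (u x * v y) - sqrt (u y * v x))\<^sup>2"
        using sqrt_mult_square_le(2)[OF mult_pos_pos[OF u_pos v_pos] mult_pos_pos[OF u_pos v_pos] _ edge_cutoff_at, of x y c]
          edge[OF False] ln_cross_diff by simp
      from mult_left_mono[OF this b_nonneg[of x y]] show ?thesis by (simp add: mult_ac)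
    qed simp
  qed
  also have "\<dots> = 4 * exp c * (\<Sum>(x, y)\<in>S \<times> S. b x y * (sqrt (u x * v y) - sqrt (u y * v x))\<^sup>2)"
    by (simp add: sum_distrib_left split_def)
  finally have "4 * exp c * B < 4 * exp c * (\<Sum>(x, y)\<in>S \<times> S. b x y * (sqrt (u x * v y) - sqrt (u y * v x))\<^sup>2)"
    using M by (rule less_le_trans[rotated])
  then show ?thesis using finS by auto
qed

text \<open>If \<open>log_quot\<close> is bounded above, it is unbounded below, since the vertex set
  is infinite and slabs are finite. Exchanging \<open>u\<close> and \<open>v\<close> then reduces to
  the previous case, as the squares are invariant.\<close>

lemma jump_sum_unbounded:
  "\<exists>S. finite S \<and> (\<Sum>(x, y)\<in>S \<times> S. b x y * (sqrt (u x * v y) - sqrt (u y * v x))\<^sup>2) > B"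
proof (cases "\<forall>t. \<exists>x. log_quot x > t")
  case True
  then show ?thesis using jump_sum_unbounded_above by blast
next
  case False
  then obtain t where t: "\<And>x. log_quot x \<le> t" by (auto simp: not_less)
  interpret swap: hardy_pair b q v u c
  proof unfold_locales
    show "(ln (v x) - ln (u x)) - (ln (v y) - ln (u y)) \<le> c" if "b x y \<noteq> 0" for x y
      using edge_bound[of y x] that by (simp add: b_sym)
    show "finite {x. lo \<le> ln (v x) - ln (u x) \<and> ln (v x) - ln (u x) \<le> hi}" for lo hi
      by (rule finite_subset[OF _ finite_level[of "- hi" "- lo"]]) auto
    show "finite {x. schroedinger b q v x \<noteq> 0 \<or> schroedinger b q u x \<noteq> 0}"
      by (rule finite_subset[OF _ finite_sources]) auto
  qed (use infinite_vertices connected u_pos v_pos u_super v_super in auto)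
  have "\<exists>x. swap.log_quot x > s" for s
  proof (rule ccontr)
    assume "\<not> ?thesis"
    then have "UNIV \<subseteq> slab (- s) t" using t by (auto simp: slab_def swap.log_quot_def log_quot_def not_less)
      (metis minus_diff_eq neg_le_iff_le)
    then show False using finite_slab infinite_vertices finite_subset by blast
  qed
  then obtain S where "finite S" "(\<Sum>(x, y)\<in>S \<times> S. b x y * (sqrt (v x * u y) - sqrt (v y * u x))\<^sup>2) > B"
    using swap.jump_sum_unbounded_above by blast
  moreover have "(sqrt (v x * u y) - sqrt (v y * u x))\<^sup>2 = (sqrt (u x * v y) - sqrt (u y * v x))\<^sup>2" for x y
    by (simp add: power2_commute mult.commute)
  ultimately show ?thesis by auto
qed

section \<open>Divergence of the weighted ground state and assembly of optimality\<close>

lemma not_summable_\<psi>: "\<not> (\<lambda>x. (\<psi> x)\<^sup>2 * w x) summable_on UNIV"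
proof
  assume sm: "(\<lambda>x. (\<psi> x)\<^sup>2 * w x) summable_on UNIV"
  obtain S where S: "finite S"
    "(\<Sum>(x, y)\<in>S \<times> S. b x y * (sqrt (u x * v y) - sqrt (u y * v x))\<^sup>2) > 2 * (\<Sum>\<^sub>\<infinity>x. (\<psi> x)\<^sup>2 * w x)"
    using jump_sum_unbounded by blast
  have "1/2 * (\<Sum>(x, y)\<in>S \<times> S. b x y * (sqrt (u x * v y) - sqrt (u y * v x))\<^sup>2)
    = (\<Sum>x\<in>S. 1/2 * (\<Sum>y\<in>S. b x y * (sqrt (u x * v y) - sqrt (u y * v x))\<^sup>2))"
    by (simp only: sum.cartesian_product[symmetric] sum_distrib_left)
  also have "\<dots> \<le> (\<Sum>x\<in>S. (\<psi> x)\<^sup>2 * w x)"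
    by (intro sum_mono \<psi>_square_w_ge S)
  also have "\<dots> \<le> (\<Sum>\<^sub>\<infinity>x. (\<psi> x)\<^sup>2 * w x)"
    using sm S(1) w_nonneg by (intro finite_sum_le_infsum) auto
  finally show False using S by simp
qed

lemma w_positive: "positive_fun w"
proof -
  have "\<exists>x. w x \<noteq> 0"
  proof (rule ccontr)
    assume "\<nexists>x. w x \<noteq> 0"
    then have "(\<lambda>x. (\<psi> x)\<^sup>2 * w x) = (\<lambda>x. 0)" by simp
    then show False using not_summable_\<psi> by simp
  qed
  then show ?thesis using w_nonneg by (simp add: positive_fun_def)
qed

lemma optimal: "optimal_Hardy_weight b q w"
proof -
  have eq: "schroedinger_form b q \<phi> - potential_form w \<phi> = schroedinger_form b (\<lambda>x. q x - w x) \<phi>"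
    if "\<phi> \<in> Cc W" for \<phi> W
    using that by (intro form_minus_potential) (simp add: Cc_def)
  have nonneg: "form_nonneg_on UNIV (\<lambda>\<phi>. schroedinger_form b q \<phi> - potential_form w \<phi>)"
    unfolding form_nonneg_on_def
  proof
    fix \<phi> :: "'a \<Rightarrow> real" assume \<phi>: "\<phi> \<in> Cc UNIV"
    then show "0 \<le> schroedinger_form b q \<phi> - potential_form w \<phi>"
      unfolding eq[OF \<phi>] by (intro form_nonneg) (simp add: Cc_def)
  qed
  have crit: "critical b q w"
  proof -
    have "form_nonneg_on UNIV (\<lambda>\<phi>. schroedinger_form b q \<phi> - potential_form w \<phi> - potential_form w' \<phi>)
      \<longleftrightarrow> form_nonneg_on UNIV (\<lambda>\<phi>. schroedinger_form b (\<lambda>x. q x - w x) \<phi> - potential_form w' \<phi>)" for w'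
      unfolding form_nonneg_on_def by (intro ball_cong refl) (simp only: eq)
    then show ?thesis using critical by (simp add: critical_def critical_form_def)
  qed
  have "ground_state b q w \<psi>"
    using in_formal_domain \<psi>_pos
    by (auto simp: ground_state_def positive_fun_def superharmonic_on_def \<psi>_harmonic less_imp_le less_imp_neq[symmetric])
  moreover have "\<not> (\<lambda>x. (f x)\<^sup>2 * w x) summable_on UNIV" if f: "ground_state b q w f" for f
  proof -
    obtain k where k: "k > 0" "\<And>x. f x = k * \<psi> x"
      using superharmonic_unique[of f] f by (auto simp: ground_state_def)
    have "(\<lambda>x. (f x)\<^sup>2 * w x) = (\<lambda>x. k\<^sup>2 * ((\<psi> x)\<^sup>2 * w x))"
      by (simp add: k power_mult_distrib mult_ac)
    then show ?thesis using not_summable_\<psi> k(1) by (simp add: summable_on_cmult_right')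
  qed
  ultimately have "null_critical b q w" using crit by (auto simp: null_critical_def)
  moreover have "optimal_near_infinity b q w"
    unfolding optimal_near_infinity_def
  proof (intro allI impI)
    fix k :: real and W :: "'a set" assume "k > 0" "finite W"
    then obtain \<phi> where \<phi>: "\<phi> \<in> Cc (UNIV - W)"
      "schroedinger_form b (\<lambda>x. q x - w x) \<phi> < k * potential_form w \<phi>"
      using not_strictly_positive_near_infinity[OF w_nonneg not_summable_\<psi>] by blast
    then show "\<not> (\<forall>\<phi>\<in>Cc (UNIV - W). schroedinger_form b q \<phi> - potential_form w \<phi> \<ge> k * potential_form w \<phi>)"
      using eq[OF \<phi>(1)] by (auto simp: not_le intro!: bexI[of _ \<phi>])
  qed
  ultimately show ?thesis
    using w_positive nonneg crit by (simp add: optimal_Hardy_weight_def)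
qed

text \<open>At such a vertex \<open>\<psi>_schroedinger\<close> retains only the squares; division
  by \<open>(\<psi> x)\<^sup>2 = u x * v x\<close> gives the formula.\<close>

lemma w_formula:
  assumes "schroedinger b q u x = 0" "schroedinger b q v x = 0"
  shows "w x = 1/2 * (\<Sum>\<^sub>\<infinity>y. b x y * (sqrt (u y / u x) - sqrt (v y / v x))\<^sup>2)"
proof -
  let ?S = "{y. b x y \<noteq> 0}"
  have "(\<Sum>\<^sub>\<infinity>y. b x y * (sqrt (u y / u x) - sqrt (v y / v x))\<^sup>2)
    = (\<Sum>\<^sub>\<infinity>y\<in>?S. b x y * (sqrt (u y / u x) - sqrt (v y / v x))\<^sup>2)"
    by (rule infsum_cong_neutral) auto
  also have "\<dots> = (\<Sum>y\<in>?S. b x y * (sqrt (u y / u x) - sqrt (v y / v x))\<^sup>2)"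
    using finite_neighbours by simp
  also have "\<dots> = (\<Sum>y\<in>?S. b x y * (sqrt (u x * v y) - sqrt (u y * v x))\<^sup>2) / (\<psi> x)\<^sup>2"
    unfolding sum_divide_distrib
  proof (rule sum.cong[OF refl])
    fix y
    have "sqrt (u y / u x) - sqrt (v y / v x) = (sqrt (u y * v x) - sqrt (u x * v y)) / \<psi> x"
      using u_pos[of x] v_pos[of x] by (simp add: \<psi>_def real_sqrt_mult real_sqrt_divide field_simps)
    then show "b x y * (sqrt (u y / u x) - sqrt (v y / v x))\<^sup>2
      = b x y * (sqrt (u x * v y) - sqrt (u y * v x))\<^sup>2 / (\<psi> x)\<^sup>2"
      by (simp add: power_divide power2_commute)
  qed
  also have "\<dots> = 2 * w x"
    using \<psi>_schroedinger[OF finite_neighbours, of x] assms \<psi>_square_w[of x] \<psi>_pos[of x]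
    by (simp add: field_simps)
  finally show ?thesis by simp
qed

end

section \<open>Passage from properness and bounded ratios to the logarithmic setting\<close>

theorem theorem1p1:
  fixes b :: "'a \<Rightarrow> 'a \<Rightarrow> real" and q u v u0 w :: "'a \<Rightarrow> real"
  assumes "countable (UNIV :: 'a set)" and "infinite (UNIV :: 'a set)"
    and "is_graph b" and "connected_graph b"
    and "positive_fun u" and "superharmonic_on b q UNIV u"
    and "positive_fun v" and "superharmonic_on b q UNIV v"
    and "\<exists>K. finite K \<and> harmonic_on b q (UNIV - K) u \<and> harmonic_on b q (UNIV - K) v"
    and "u0 = (\<lambda>x. u x / v x)"
    and "proper_pos u0"
    and "bdd_above {u0 x / u0 y | x y. adj b x y}"
    and "w = (\<lambda>x. schroedinger b q (\<lambda>y. sqrt (u y * v y)) x / sqrt (u x * v x))"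
  shows "optimal_Hardy_weight b q w \<and>
    (\<forall>x. schroedinger b q u x = 0 \<and> schroedinger b q v x = 0 \<longrightarrow>
       w x = 1/2 * (\<Sum>\<^sub>\<infinity>y. b x y * (sqrt (u y / u x) - sqrt (v y / v x))\<^sup>2))"
proof -
  note graph = \<open>is_graph b\<close>
  have u: "u x > 0" and v: "v x > 0" for x
    using superharmonic_positive_pos[OF assms(3-6)] superharmonic_positive_pos[OF assms(3,4,7,8)] .
  have lu: "ln (u0 x) = ln (u x) - ln (v x)" and u0: "u0 x > 0" for x
    using u v by (simp_all add: assms(10) ln_div less_imp_neq[symmetric])
  obtain C where C: "\<And>x y. adj b x y \<Longrightarrow> u0 x / u0 y \<le> C"
    using assms(12) unfolding bdd_above_def by blast
  have sym: "adj b x y \<Longrightarrow> adj b y x" for x y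
    using graph by (simp add: is_graph_def adj_def)
  \<comment> \<open>The maximum with \<open>1\<close> keeps the argument of the logarithm
    positive.\<close>
  define c where "c = ln (max 1 C)"
  have edge: "ln (u0 x) - ln (u0 y) \<le> c" if "adj b x y" for x y
  proof -
    have "ln (u0 x) - ln (u0 y) = ln (u0 x / u0 y)" using u0 by (simp add: ln_div less_imp_neq[symmetric])
    also have "\<dots> \<le> c" unfolding c_def using C[OF that] u0 by (subst ln_le_cancel_iff) auto
    finally show ?thesis .
  qed
  have level: "finite {x. lo \<le> ln (u0 x) \<and> ln (u0 x) \<le> hi}" for lo hi
  proof -
    have "compact {exp lo..exp hi} \<and> {exp lo..exp hi} \<subseteq> {0<..}"
      by (auto intro: less_le_trans[OF exp_gt_zero])
    then have "finite (u0 -` {exp lo..exp hi})" using assms(11) unfolding proper_pos_def by blast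
    moreover have "u0 x \<le> exp hi \<longleftrightarrow> ln (u0 x) \<le> hi" for x
      using u0[of x] by (metis exp_le_cancel_iff exp_ln)
    then have "u0 -` {exp lo..exp hi} = {x. lo \<le> ln (u0 x) \<and> ln (u0 x) \<le> hi}"
      using u0 by (auto simp: ln_ge_iff)
    ultimately show ?thesis by simp
  qed
  obtain K where K: "finite K" "harmonic_on b q (UNIV - K) u" "harmonic_on b q (UNIV - K) v"
    using assms(9) by blast
  interpret hardy_pair b q u v c
  proof unfold_locales
    have nb: "adj b x y" if "b x y \<noteq> 0" for x y
      using graph that by (simp add: is_graph_def adj_def less_le)
    show "(ln (u x) - ln (v x)) - (ln (u y) - ln (v y)) \<le> c" if "b x y \<noteq> 0" for x y
      using edge[OF nb[OF that]] by (simp add: lu)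
    show "finite {x. lo \<le> ln (u x) - ln (v x) \<and> ln (u x) - ln (v x) \<le> hi}" for lo hi
      using level by (simp add: lu)
    \<comment> \<open>Local finiteness: all neighbours of \<open>x\<close> lie in the finite slab of
      width \<open>c\<close> around the level of \<open>x\<close>.\<close>
    show "finite {y. b x y \<noteq> 0}" for x
      by (rule finite_subset[OF _ level[of "ln (u0 x) - c" "ln (u0 x) + c"]])
        (use edge nb sym in force)
    show "finite {x. schroedinger b q u x \<noteq> 0 \<or> schroedinger b q v x \<noteq> 0}"
      by (rule finite_subset[OF _ K(1)]) (use K in \<open>auto simp: harmonic_on_def\<close>)
  qed (use assms u v in \<open>auto simp: superharmonic_on_def\<close>)
  have "w = hardy_pair.w b q u v"
    by (simp add: assms(13) fun_eq_iff w_def \<psi>_def[abs_def])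
  then show ?thesis using optimal w_formula by simp
qed

end
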